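(* Let $A\in\mathbb{Z}^{m\times d}$ with $\ker_{\mathbb{Z}}(A)\cap\mathbb{N}^d=\{0\}$ and let $\mathcal{M}$ be a Markov basis for $\mathcal{P}_A$. Then there exists a constant $C\in\mathbb{N}$ such that $\operatorname{diam}(\mathcal{F}^c(\mathcal{M}))\le C$ for all $\mathcal{F}\in\mathcal{P}_A$.
   Context: $\mathbb{N}=\{0,1,2,\dots\}$. For $A\in\mathbb{Z}^{m\times d}$ and $b\in\mathbb{Z}^m$, the $b$-fiber of $A$ is $\mathcal{F}_{A,b}:=\{u\in\mathbb{N}^d: Au=b\}$, and $\mathcal{P}_A:=\{\mathcal{F}_{A,b}: b\in\mathbb{N}A\}$, where $\mathbb{N}A$ is the semigroup generated by the columns of $A$. For finite sets $\mathcal{F},\mathcal{M}\subset\mathbb{Z}^d$, $\mathcal{F}(\mathcal{M})$ is the graph on node set $\mathcal{F}$ in which $u,v$ are adjacent if $u-v\in\mathcal{M}$ or $v-u\in\mathcal{M}$. The compression of $\mathcal{F}(\mathcal{M})$ is the graph $\mathcal{F}^c(\mathcal{M}):=\mathcal{F}(\mathbb{Z}\cdot\mathcal{M})$, where $\mathbb{Z}\cdot\mathcal{M}:=\{\lambda m:\lambda\in\mathbb{Z},m\in\mathcal{M}\}$. A finite set $\mathcal{M}\subset\mathbb{Z}^d$ is a Markov basis of a collection $\mathcal{P}$ of finite subsets of $\mathbb{Z}^d$ if $\mathcal{F}(\mathcal{M})$ is connected for every $\mathcal{F}\in\mathcal{P}$. The diameter $\operatorname{diam}$ of a graph is the maximum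 graph distance between two of its nodes (infinite if disconnected). *)

theory Defs
  imports
    "HOL-Analysis.Cartesian_Space"
    "Graph_Theory.Digraph_Component"
    "Graph_Theory.Shortest_Path"
begin

text \<open>Vectors of \<open>\<nat>\<^sup>d\<close> are represented as the nonnegative vectors of \<^typ>\<open>int ^ 'd\<close>.\<close>

definition nonneg_vecs :: "(int ^ 'd) set" where
  "nonneg_vecs = {u. \<forall>i. 0 \<le> u $ i}"

definition int_kernel :: "int ^ 'd ^ 'm \<Rightarrow> (int ^ 'd) set" where
  "int_kernel A = {u. A *v u = 0}"

definition fiber :: "int ^ 'd ^ 'm \<Rightarrow> int ^ 'm \<Rightarrow> (int ^ 'd) set" where
  "fiber A b = {u \<in> nonneg_vecs. A *v u = b}"

definition column_semigroup :: "int ^ 'd ^ 'm \<Rightarrow> (int ^ 'm) set" where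
  "column_semigroup A = {\<Sum>j\<in>UNIV. int (c j) *s column j A | c :: 'd \<Rightarrow> nat. True}"

definition fibers :: "int ^ 'd ^ 'm \<Rightarrow> (int ^ 'd) set set" where
  "fibers A = fiber A ` column_semigroup A"

text \<open>
  An undirected graph is a symmetric digraph: an edge between \<open>u\<close> and \<open>v\<close> is the pair of
  arcs \<open>(u, v)\<close> and \<open>(v, u)\<close>. If \<open>0 \<in> M\<close>, every node carries a loop; loops affect
  neither connectedness nor distances.
\<close>

definition move_graph ::
    "(int ^ 'd) set \<Rightarrow> (int ^ 'd) set \<Rightarrow> (int ^ 'd, (int ^ 'd) \<times> (int ^ 'd)) pre_digraph" where
  "move_graph F M =
    \<lparr>verts = F,
     arcs = {(u, v). u \<in> F \<and> v \<in> F \<and> (u - v \<in> M \<or> v - u \<in> M)},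
     tail = fst, head = snd\<rparr>"

definition int_multiples :: "(int ^ 'd) set \<Rightarrow> (int ^ 'd) set" where
  "int_multiples M = {l *s m | l m. m \<in> M}"

definition compression ::
    "(int ^ 'd) set \<Rightarrow> (int ^ 'd) set \<Rightarrow> (int ^ 'd, (int ^ 'd) \<times> (int ^ 'd)) pre_digraph" where
  "compression F M = move_graph F (int_multiples M)"

definition markov_basis :: "(int ^ 'd) set \<Rightarrow> (int ^ 'd) set set \<Rightarrow> bool" where
  "markov_basis M P \<longleftrightarrow> finite M \<and> (\<forall>F\<in>P. Digraph_Component.connected (move_graph F M))"

text \<open>
  With unit arc costs, \<^const>\<open>wf_digraph.\<mu>\<close> is the least number of arcs in a walk, and
  \<open>\<infinity>\<close> if there is no walk. For a finite nonempty graph the supremum is a maximum.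
\<close>

definition graph_dist :: "('a, 'b) pre_digraph \<Rightarrow> 'a \<Rightarrow> 'a \<Rightarrow> ereal" where
  "graph_dist G u v = wf_digraph.\<mu> G (\<lambda>_. 1) u v"

definition graph_diam :: "('a, 'b) pre_digraph \<Rightarrow> ereal" where
  "graph_diam G = (SUP u\<in>verts G. SUP v\<in>verts G. graph_dist G u v)"

lemma sym_digraph_move_graph: "sym_digraph (move_graph F M)"
  by unfold_locales
    (auto simp: move_graph_def symmetric_def arcs_ends_def arc_to_ends_def image_iff intro!: symI)

text \<open>
  Walk-level description of distances, as a check that the locale constant
  \<^const>\<open>wf_digraph.\<mu>\<close> has its intended meaning on these graphs.
\<close>

lemma graph_dist_move_graph:
  "graph_dist (move_graph F M) u v =
    (INF p\<in>{p. pre_digraph.awalk (move_graph F M) u p v}. ereal (real (length p)))"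
proof -
  interpret sym_digraph "move_graph F M" by (rule sym_digraph_move_graph)
  show ?thesis
    by (simp add: graph_dist_def \<mu>_def awalk_cost_def sum_list_triv)
qed

end

theory Submission
  imports Defs
begin

text \<open>
  The monoid of all pairs \<open>(u, v)\<close> of nonnegative vectors with \<open>A u = A v\<close> is generated by
  finitely many pairs \<open>(p\<^sub>g, q\<^sub>g)\<close>, by Dickson's lemma. Each \<open>p\<^sub>g\<close> is joined to \<open>q\<^sub>g\<close> by a path
  of some length \<open>n\<^sub>g\<close> using moves from \<open>M\<close>. If \<open>(u, v) = \<Sum> c\<^sub>g (p\<^sub>g, q\<^sub>g)\<close>, one gets from \<open>u\<close>
  to \<open>v\<close> by replacing \<open>c\<^sub>g p\<^sub>g\<close> by \<open>c\<^sub>g q\<^sub>g\<close> for one generator after the other. Scaling the path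
  from \<open>p\<^sub>g\<close> to \<open>q\<^sub>g\<close> by \<open>c\<^sub>g\<close> and translating it by the remaining nonnegative summands does this
  with \<open>n\<^sub>g\<close> moves of the compression, so \<open>\<Sum> n\<^sub>g\<close> bounds all diameters.
\<close>

section \<open>Dickson's lemma and finite generation\<close>

text \<open>Some subsequence is monotone. If it decreases, it is constant from an index where its
  minimum is attained, so a tail of it is weakly increasing.\<close>

lemma nat_seq_mono_subseq:
  fixes s :: "nat \<Rightarrow> nat"
  shows "\<exists>r :: nat \<Rightarrow> nat. strict_mono r \<and> mono (\<lambda>n. s (r n))"
proof -
  obtain r where r: "strict_mono r" "monoseq (\<lambda>n. s (r n))"
    using seq_monosub[of s] by blast
  show ?thesis
  proof (cases "incseq (\<lambda>n. s (r n))")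
    case True
    then show ?thesis using r(1) by blast
  next
    case False
    with r(2) have dec: "decseq (\<lambda>n. s (r n))"
      by (simp add: monoseq_iff)
    obtain N where N: "\<And>n. s (r N) \<le> s (r n)"
      using ex_has_least_nat[of "\<lambda>_. True" 0 "\<lambda>n. s (r n)"] by auto
    have const: "s (r (n + N)) = s (r N)" for n
      using decseqD[OF dec, of N "n + N"] N[of "n + N"] by simp
    have "strict_mono (\<lambda>n. r (n + N))"
      using r(1) by (simp add: strict_mono_def)
    then show ?thesis
      using const by (intro exI[of _ "\<lambda>n. r (n + N)"]) (simp add: mono_def)
  qed
qed

text \<open>Coordinates are treated one at a time: thinning out a sequence further keeps the
  monotonicity already reached.\<close>

lemma mono_subseq_coordinates:
  fixes f :: "nat \<Rightarrow> 'k \<Rightarrow> nat"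
  assumes "finite K"
  shows "\<exists>r :: nat \<Rightarrow> nat. strict_mono r \<and> (\<forall>k\<in>K. mono (\<lambda>n. f (r n) k))"
  using assms
proof (induction K)
  case empty
  then show ?case by (auto intro: exI[of _ id] simp: strict_mono_def)
next
  case (insert k K)
  then obtain r :: "nat \<Rightarrow> nat" where r: "strict_mono r" "\<forall>k\<in>K. mono (\<lambda>n. f (r n) k)" by blast
  obtain r' :: "nat \<Rightarrow> nat" where r': "strict_mono r'" "mono (\<lambda>n. f (r (r' n)) k)"
    using nat_seq_mono_subseq[of "\<lambda>n. f (r n) k"] by blast
  have "mono (\<lambda>n. f (r (r' n)) j)" if "j \<in> K" for j
    using r(2) that r'(1) by (auto simp: mono_def strict_mono_less_eq)
  then show ?case
    using r r' by (intro exI[of _ "r \<circ> r'"]) (auto simp: strict_mono_def o_def)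
qed

text \<open>An infinite antichain would contain an injective sequence; along a subsequence
  increasing in every coordinate, its first two terms are comparable and distinct.\<close>

lemma dickson:
  fixes X :: "('k::finite \<Rightarrow> nat) set"
  assumes antichain: "\<And>x y. x \<in> X \<Longrightarrow> y \<in> X \<Longrightarrow> x \<le> y \<Longrightarrow> x = y"
  shows "finite X"
proof (rule ccontr)
  assume "infinite X"
  then obtain f :: "nat \<Rightarrow> 'k \<Rightarrow> nat" where f: "inj f" "range f \<subseteq> X"
    using infinite_countable_subset by blast
  obtain r :: "nat \<Rightarrow> nat" where r: "strict_mono r" "\<forall>k\<in>UNIV. mono (\<lambda>n. f (r n) k)"
    using mono_subseq_coordinates[of UNIV f] by auto
  have "f (r 0) \<le> f (r 1)"
    using r(2) by (auto simp: le_fun_def mono_def)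
  with f have "r 0 = r 1"
    by (meson antichain injD rangeI subsetD)
  with r(1) show False
    by (metis strict_mono_eq zero_neq_one)
qed

text \<open>The minimal nonzero elements generate \<open>S\<close>. They form an antichain, and
  subtracting one of them from a nonzero element stays in \<open>S\<close> and lowers the coordinate
  sum, so repeated subtraction ends at zero.\<close>

lemma finitely_generated_nat_vectors:
  fixes S :: "('k::finite \<Rightarrow> nat) set"
  assumes diff: "\<And>x y. x \<in> S \<Longrightarrow> y \<in> S \<Longrightarrow> y \<le> x \<Longrightarrow> (\<lambda>k. x k - y k) \<in> S"
  shows "\<exists>G. finite G \<and> G \<subseteq> S \<and> (\<forall>x\<in>S. \<exists>c. \<forall>k. x k = (\<Sum>g\<in>G. c g * g k))"
proof -
  define G where "G = {x \<in> S. x \<noteq> (\<lambda>_. 0) \<and> (\<forall>y\<in>S. y \<noteq> (\<lambda>_. 0) \<longrightarrow> y \<le> x \<longrightarrow> y = x)}"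
  have fin: "finite G"
    by (rule dickson) (auto simp: G_def)
  have size_less: "sum y UNIV < sum x UNIV" if "y \<le> x" "y \<noteq> x" for x y :: "'k \<Rightarrow> nat"
    using that by (intro sum_strict_mono_ex1) (auto simp: le_fun_def fun_eq_iff order_less_le)
  have below: "\<exists>g\<in>G. g \<le> x" if "x \<in> S" "x \<noteq> (\<lambda>_. 0)" for x
    using that
  proof (induction x rule: measure_induct_rule[of "\<lambda>x. sum x UNIV"])
    case (less x)
    show ?case
    proof (cases "x \<in> G")
      case False
      with less.prems obtain y where y: "y \<in> S" "y \<noteq> (\<lambda>_. 0)" "y \<le> x" "y \<noteq> x"
        by (auto simp: G_def)
      with less.IH[OF size_less] show ?thesis
        by (meson order_trans)
    qed auto
  qed
  have "\<exists>c. \<forall>k. x k = (\<Sum>g\<in>G. c g * g k)" if "x \<in> S" for x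
    using that
  proof (induction x rule: measure_induct_rule[of "\<lambda>x. sum x UNIV"])
    case (less x)
    show ?case
    proof (cases "x = (\<lambda>_. 0)")
      case True
      then show ?thesis by (intro exI[of _ "\<lambda>_. 0"]) simp
    next
      case False
      with below less.prems obtain g where g: "g \<in> G" "g \<le> x" by blast
      define y where "y = (\<lambda>k. x k - g k)"
      have x: "x k = y k + g k" for k
        using g(2) by (simp add: y_def le_fun_def)
      have "y \<in> S"
        using diff g less.prems by (auto simp: y_def G_def)
      moreover have "y \<noteq> x"
        using g(1) x by (auto simp: G_def fun_eq_iff)
      then have "sum y UNIV < sum x UNIV"
        by (intro size_less) (auto simp: x le_fun_def)
      ultimately obtain c where c: "\<And>k. y k = (\<Sum>g\<in>G. c g * g k)"
        using less.IH by blast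
      \<comment> \<open>Restoring the subtracted \<open>g\<close> raises its coefficient by
        one.\<close>
      have "x k = (\<Sum>h\<in>G. (c(g := c g + 1)) h * h k)" for k
        unfolding x c using fin g(1)
        by (simp add: sum.remove[of G g] algebra_simps)
      then show ?thesis by blast
    qed
  qed
  with fin show ?thesis
    by (intro exI[of _ G]) (auto simp: G_def)
qed

section \<open>Paths in fibers\<close>

lemma arcs_ends_move_graph:
  "arcs_ends (move_graph F M) = {(u, v). u \<in> F \<and> v \<in> F \<and> (u - v \<in> M \<or> v - u \<in> M)}"
  by (auto simp: arcs_ends_def arc_to_ends_def move_graph_def image_iff)

text \<open>Paths are handled as powers of the adjacency relation, which compose by adding
  exponents; this turns them back into the walks that define distance.\<close>

lemma awalk_of_relpow:
  assumes "wf_digraph G" "(u, v) \<in> arcs_ends G ^^ n" "u \<in> verts G"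
  shows "\<exists>p. pre_digraph.awalk G u p v \<and> length p = n"
proof -
  interpret wf_digraph G by fact
  show ?thesis
    using assms(2,3)
  proof (induction n arbitrary: u)
    case 0
    then show ?case by (auto simp: awalk_Nil_iff)
  next
    case (Suc n)
    from Suc.prems(1) obtain w where w: "(u, w) \<in> arcs_ends G" "(w, v) \<in> arcs_ends G ^^ n"
      by (meson relpow_Suc_D2)
    then obtain e where e: "e \<in> arcs G" "tail G e = u" "head G e = w"
      by (auto simp: arcs_ends_def arc_to_ends_def)
    with Suc.IH[OF w(2)] obtain p where "awalk w p v" "length p = n" by auto
    with e show ?case
      by (intro exI[of _ "e # p"]) (auto simp: awalk_Cons_iff)
  qed
qed

lemma graph_dist_le_relpow:
  assumes "(u, v) \<in> arcs_ends (move_graph F M) ^^ n" "u \<in> F"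
  shows "graph_dist (move_graph F M) u v \<le> ereal (real n)"
proof -
  interpret sym_digraph "move_graph F M" by (rule sym_digraph_move_graph)
  obtain p where "awalk u p v" "length p = n"
    using awalk_of_relpow[OF wf_digraph_axioms assms(1)] assms(2) by (auto simp: move_graph_def)
  then show ?thesis
    unfolding graph_dist_move_graph by (intro INF_lower2[of p]) auto
qed

text \<open>Symmetry of the arcs makes connectedness the same as directed reachability.\<close>

lemma connected_imp_relpow:
  assumes "Digraph_Component.connected (move_graph F M)" "u \<in> F" "v \<in> F"
  shows "\<exists>n. (u, v) \<in> arcs_ends (move_graph F M) ^^ n"
proof -
  interpret sym_digraph "move_graph F M" by (rule sym_digraph_move_graph)
  have "u \<rightarrow>\<^sup>*\<^bsub>move_graph F M\<^esub> v"
    using symmetric_connected_imp_strongly_connected[OF sym_arcs assms(1)] assms(2,3)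
    by (auto simp: move_graph_def strongly_connected_def)
  then have "(u, v) \<in> (arcs_ends (move_graph F M))\<^sup>*"
    by (simp add: reachable_def rtrancl_on_rtranclI)
  then show ?thesis by (simp add: rtrancl_power)
qed

lemma nonneg_vecs_add: "u \<in> nonneg_vecs \<Longrightarrow> v \<in> nonneg_vecs \<Longrightarrow> u + v \<in> nonneg_vecs"
  by (simp add: nonneg_vecs_def)

lemma nonneg_vecs_smult: "0 \<le> l \<Longrightarrow> u \<in> nonneg_vecs \<Longrightarrow> l *s u \<in> nonneg_vecs"
  by (simp add: nonneg_vecs_def)

lemma nonneg_vecs_sum: "(\<And>g. g \<in> G \<Longrightarrow> f g \<in> nonneg_vecs) \<Longrightarrow> sum f G \<in> nonneg_vecs"
  by (simp add: nonneg_vecs_def sum_nonneg)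

lemma matrix_vector_smult:
  fixes A :: "'a::comm_semiring_1 ^ 'd ^ 'm"
  shows "A *v (l *s u) = l *s (A *v u)"
  by (simp add: matrix_vector_mult_def vec_eq_iff sum_distrib_left mult_ac)

text \<open>The map sending \<open>x\<close> to \<open>w + l *s x\<close> multiplies differences by
  \<open>l\<close>, so a move becomes a multiple of a move. As \<open>l\<close> and \<open>w\<close>
  are nonnegative, all nodes of the path land in one fiber.\<close>

lemma scaled_translated_path:
  fixes A :: "int ^ 'd ^ 'm"
  assumes "(p, q) \<in> arcs_ends (move_graph (fiber A b) M) ^^ n"
    and "0 \<le> l" "w \<in> nonneg_vecs"
  shows "(w + l *s p, w + l *s q)
    \<in> arcs_ends (compression (fiber A (A *v w + l *s b)) M) ^^ n"
  using assms(1)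
proof (induction n arbitrary: q)
  case 0
  then show ?case by simp
next
  case (Suc n)
  then obtain r where pr: "(p, r) \<in> arcs_ends (move_graph (fiber A b) M) ^^ n"
    and rq: "r \<in> fiber A b" "q \<in> fiber A b" "r - q \<in> M \<or> q - r \<in> M"
    by (auto simp: arcs_ends_move_graph)
  have mem: "w + l *s x \<in> fiber A (A *v w + l *s b)" if "x \<in> fiber A b" for x
    using that assms(2,3)
    by (auto simp: fiber_def nonneg_vecs_add nonneg_vecs_smult matrix_vector_right_distrib
        matrix_vector_smult)
  have "(w + l *s x) - (w + l *s y) = l *s (x - y)" for x y :: "int ^ 'd"
    by (simp add: vec_eq_iff algebra_simps)
  with mem rq have "(w + l *s r, w + l *s q)
    \<in> arcs_ends (compression (fiber A (A *v w + l *s b)) M)"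
    unfolding compression_def arcs_ends_move_graph int_multiples_def by auto
  with Suc.IH[OF pr] show ?case by auto
qed

text \<open>Induction on \<open>G\<close> with \<open>w\<close> arbitrary: \<open>w\<close> collects
  the summands already exchanged, so the second half of the path starts from a new
  \<open>w\<close>.\<close>

lemma combined_path:
  fixes A :: "int ^ 'd ^ 'm" and l :: "'g \<Rightarrow> int"
  assumes "finite G"
    and "\<And>g. g \<in> G \<Longrightarrow> p g \<in> nonneg_vecs" "\<And>g. g \<in> G \<Longrightarrow> q g \<in> nonneg_vecs"
    and "\<And>g. g \<in> G \<Longrightarrow> A *v q g = A *v p g"
    and "\<And>g. g \<in> G \<Longrightarrow> (p g, q g) \<in> arcs_ends (move_graph (fiber A (A *v p g)) M) ^^ n g"
    and "\<And>g. 0 \<le> l g" "w \<in> nonneg_vecs"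
  shows "(w + (\<Sum>g\<in>G. l g *s p g), w + (\<Sum>g\<in>G. l g *s q g))
    \<in> arcs_ends (compression (fiber A (A *v (w + (\<Sum>g\<in>G. l g *s p g)))) M) ^^ (\<Sum>g\<in>G. n g)"
  using assms
proof (induction G arbitrary: w)
  case empty
  then show ?case by simp
next
  case (insert x G)
  let ?P = "\<Sum>g\<in>G. l g *s p g" and ?Q = "\<Sum>g\<in>G. l g *s q g"
  let ?F = "fiber A (A *v (w + (l x *s p x + ?P)))"
  have "?P \<in> nonneg_vecs"
    using insert.prems by (intro nonneg_vecs_sum nonneg_vecs_smult) auto
  then have "w + ?P \<in> nonneg_vecs"
    using insert.prems by (simp add: nonneg_vecs_add)
  \<comment> \<open>While \<open>x\<close> is exchanged, the summands \<open>?P\<close> still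
    waiting belong to the translation.\<close>
  then have "((w + ?P) + l x *s p x, (w + ?P) + l x *s q x)
      \<in> arcs_ends (compression (fiber A (A *v (w + ?P) + l x *s (A *v p x))) M) ^^ n x"
    using insert.prems by (intro scaled_translated_path) auto
  then have first: "(w + (l x *s p x + ?P), w + l x *s q x + ?P)
      \<in> arcs_ends (compression ?F M) ^^ n x"
    by (simp add: matrix_vector_right_distrib matrix_vector_smult algebra_simps)
  have "w + l x *s q x \<in> nonneg_vecs"
    using insert.prems by (simp add: nonneg_vecs_add nonneg_vecs_smult)
  then have "(w + l x *s q x + ?P, w + l x *s q x + ?Q)
      \<in> arcs_ends (compression (fiber A (A *v (w + l x *s q x + ?P))) M) ^^ (\<Sum>g\<in>G. n g)"
    using insert.prems by (intro insert.IH) auto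
  \<comment> \<open>Both halves run in the same fiber, since \<open>p x\<close> and
    \<open>q x\<close> have the same image under \<open>A\<close>.\<close>
  moreover have "A *v (w + l x *s q x + ?P) = A *v (w + (l x *s p x + ?P))"
    using insert.prems(3)[of x]
    by (simp add: matrix_vector_right_distrib matrix_vector_smult)
  ultimately have "(w + l x *s q x + ?P, w + (l x *s q x + ?Q))
      \<in> arcs_ends (compression ?F M) ^^ (\<Sum>g\<in>G. n g)"
    by (simp add: add.assoc)
  with first have "(w + (l x *s p x + ?P), w + (l x *s q x + ?Q))
      \<in> arcs_ends (compression ?F M) ^^ (n x + (\<Sum>g\<in>G. n g))"
    by (auto simp: relpow_add)
  then show ?case
    using insert.hyps by simp
qed

section \<open>Generators of the pairs in a common fiber\<close>

text \<open>The coordinates of \<open>u\<close> serve as the coefficients of the columns. This makes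
  the Markov property available for the fiber of each generator.\<close>

lemma fiber_in_fibers:
  fixes A :: "int ^ 'd ^ 'm"
  assumes "u \<in> nonneg_vecs"
  shows "fiber A (A *v u) \<in> fibers A"
proof -
  have "A *v u = (\<Sum>j\<in>UNIV. int (nat (u $ j)) *s column j A)"
    using assms by (simp add: nonneg_vecs_def matrix_mult_sum)
  then have "A *v u \<in> column_semigroup A"
    unfolding column_semigroup_def
    by (intro CollectI exI[of _ "\<lambda>j. nat (u $ j)"] conjI TrueI)
  then show ?thesis
    unfolding fibers_def by (rule imageI)
qed

definition int_vec :: "('d \<Rightarrow> nat) \<Rightarrow> int ^ 'd" where
  "int_vec f = (\<chi> i. int (f i))"

lemma int_vec_nonneg: "int_vec f \<in> nonneg_vecs"
  by (simp add: int_vec_def nonneg_vecs_def)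

lemma nonneg_vecs_int_vec: "u \<in> nonneg_vecs \<Longrightarrow> int_vec (\<lambda>i. nat (u $ i)) = u"
  by (simp add: int_vec_def nonneg_vecs_def vec_eq_iff)

lemma int_vec_sum: "int_vec (\<lambda>i. \<Sum>g\<in>G. c g * f g i) = (\<Sum>g\<in>G. int (c g) *s int_vec (f g))"
  by (simp add: int_vec_def vec_eq_iff)

text \<open>A pair is encoded as one function on \<open>'d + 'd\<close>, with \<open>Inl\<close> for
  the first vector and \<open>Inr\<close> for the second. Having equal images is a linear condition,
  so it survives subtraction.\<close>

lemma finitely_generated_fiber_pairs:
  fixes A :: "int ^ 'd ^ 'm"
  obtains G :: "('d + 'd \<Rightarrow> nat) set"
  where "finite G"
    and "\<forall>g\<in>G. A *v int_vec (g \<circ> Inr) = A *v int_vec (g \<circ> Inl)"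
    and "\<forall>u\<in>nonneg_vecs. \<forall>v\<in>nonneg_vecs. A *v u = A *v v \<longrightarrow>
      (\<exists>c. u = (\<Sum>g\<in>G. int (c g) *s int_vec (g \<circ> Inl)) \<and>
           v = (\<Sum>g\<in>G. int (c g) *s int_vec (g \<circ> Inr)))"
proof -
  define S where
    "S = {x :: 'd + 'd \<Rightarrow> nat. A *v int_vec (x \<circ> Inr) = A *v int_vec (x \<circ> Inl)}"
  have diff: "(\<lambda>k. x k - y k) \<in> S" if "x \<in> S" "y \<in> S" "y \<le> x" for x y
  proof -
    have "int_vec ((\<lambda>k. x k - y k) \<circ> h) = int_vec (x \<circ> h) - int_vec (y \<circ> h)" for h :: "'d \<Rightarrow> 'd + 'd"
      using that(3) by (simp add: int_vec_def vec_eq_iff le_fun_def of_nat_diff)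
    with that show ?thesis
      by (simp add: S_def matrix_vector_mult_diff_distrib)
  qed
  have "\<exists>G. finite G \<and> G \<subseteq> S \<and> (\<forall>x\<in>S. \<exists>c. \<forall>k. x k = (\<Sum>g\<in>G. c g * g k))"
    by (rule finitely_generated_nat_vectors) (rule diff)
  then obtain G where G: "finite G" "G \<subseteq> S"
    "\<forall>x\<in>S. \<exists>c. \<forall>k. x k = (\<Sum>g\<in>G. c g * g k)"
    by (elim exE conjE)
  show thesis
  proof (rule that[OF G(1)]; intro ballI impI)
    fix g assume "g \<in> G"
    with G(2) show "A *v int_vec (g \<circ> Inr) = A *v int_vec (g \<circ> Inl)"
      by (auto simp: S_def)
  next
    fix u v :: "int ^ 'd"
    assume uv: "u \<in> nonneg_vecs" "v \<in> nonneg_vecs" "A *v u = A *v v"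
    define x where "x = case_sum (\<lambda>i. nat (u $ i)) (\<lambda>i. nat (v $ i))"
    have x: "int_vec (x \<circ> Inl) = u" "int_vec (x \<circ> Inr) = v"
      using uv by (simp_all add: x_def o_def nonneg_vecs_int_vec)
    with uv(3) have "x \<in> S" by (simp add: S_def)
    with G(3) obtain c where c: "\<And>k. x k = (\<Sum>g\<in>G. c g * g k)" by blast
    have sums: "int_vec (x \<circ> h) = (\<Sum>g\<in>G. int (c g) *s int_vec (g \<circ> h))" for h :: "'d \<Rightarrow> 'd + 'd"
      using int_vec_sum[of c "\<lambda>g. g \<circ> h" G] by (simp add: o_def c)
    show "\<exists>c. u = (\<Sum>g\<in>G. int (c g) *s int_vec (g \<circ> Inl)) \<and>
          v = (\<Sum>g\<in>G. int (c g) *s int_vec (g \<circ> Inr))"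
      using sums[of Inl, unfolded x] sums[of Inr, unfolded x] by blast
  qed
qed

theorem theorem3p15:
  fixes A :: "int ^ 'd ^ 'm" and M :: "(int ^ 'd) set"
  assumes "int_kernel A \<inter> nonneg_vecs = {0}"
    and "markov_basis M (fibers A)"
  shows "\<exists>C :: nat. \<forall>F \<in> fibers A. graph_diam (compression F M) \<le> ereal (real C)"
proof -
  obtain G :: "('d + 'd \<Rightarrow> nat) set" where G: "finite G"
    "\<forall>g\<in>G. A *v int_vec (g \<circ> Inr) = A *v int_vec (g \<circ> Inl)"
    "\<forall>u\<in>nonneg_vecs. \<forall>v\<in>nonneg_vecs. A *v u = A *v v \<longrightarrow>
      (\<exists>c. u = (\<Sum>g\<in>G. int (c g) *s int_vec (g \<circ> Inl)) \<and>
           v = (\<Sum>g\<in>G. int (c g) *s int_vec (g \<circ> Inr)))"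
    by (rule finitely_generated_fiber_pairs[of A])
  define p q where "p g = int_vec (g \<circ> Inl)" and "q g = int_vec (g \<circ> Inr)"
    for g :: "'d + 'd \<Rightarrow> nat"
  note nonneg = int_vec_nonneg[of "g \<circ> Inl" for g :: "'d + 'd \<Rightarrow> nat", folded p_def]
    int_vec_nonneg[of "g \<circ> Inr" for g :: "'d + 'd \<Rightarrow> nat", folded q_def]
  note G = G[folded p_def q_def]
  have "\<exists>n. (p g, q g) \<in> arcs_ends (move_graph (fiber A (A *v p g)) M) ^^ n" if "g \<in> G" for g
  proof (rule connected_imp_relpow)
    show "Digraph_Component.connected (move_graph (fiber A (A *v p g)) M)"
      using assms(2) fiber_in_fibers[of "p g" A] nonneg(1) by (simp add: markov_basis_def)
  qed (use G(2) that nonneg in \<open>auto simp: fiber_def\<close>)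
  \<comment> \<open>One path length is fixed per generator, independently of any fiber, so
    \<open>sum n G\<close> is a uniform bound.\<close>
  then obtain n where
    n: "\<And>g. g \<in> G \<Longrightarrow> (p g, q g) \<in> arcs_ends (move_graph (fiber A (A *v p g)) M) ^^ n g"
    by metis
  have "graph_dist (compression F M) u v \<le> ereal (real (sum n G))"
    if F: "F \<in> fibers A" "u \<in> F" "v \<in> F" for F u v
  proof -
    have uv: "u \<in> nonneg_vecs" "v \<in> nonneg_vecs" "A *v u = A *v v" "F = fiber A (A *v u)"
      using F by (auto simp: fibers_def fiber_def)
    with G(3) obtain c where c: "u = (\<Sum>g\<in>G. int (c g) *s p g)" "v = (\<Sum>g\<in>G. int (c g) *s q g)"
      by blast
    \<comment> \<open>The coefficients \<open>c\<close> depend on \<open>u\<close> and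
      \<open>v\<close> but enter only as scaling factors, never in the length.\<close>
    have "(0 + (\<Sum>g\<in>G. int (c g) *s p g), 0 + (\<Sum>g\<in>G. int (c g) *s q g))
      \<in> arcs_ends (compression (fiber A (A *v (0 + (\<Sum>g\<in>G. int (c g) *s p g)))) M) ^^ sum n G"
      using G n nonneg by (intro combined_path) (auto simp: nonneg_vecs_def)
    then have "(u, v) \<in> arcs_ends (compression F M) ^^ sum n G"
      by (simp add: uv(4) flip: c)
    with F(2) show ?thesis
      unfolding compression_def by (intro graph_dist_le_relpow)
  qed
  then show ?thesis
    unfolding graph_diam_def
    by (intro exI[of _ "sum n G"] ballI SUP_least) (auto simp: compression_def move_graph_def)
qed

end
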